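(* Let $\lambda$ be a nonzero real number, $\alpha$ a nonzero complex number, $r\ge0$ an integer and $m$ a positive odd integer. Then for every integer $n\ge0$, $$\sum_{k=0}^{m-1}(-1)^{k}A_{n,\lambda}^{(r,\alpha)}\Big(\frac{x+k}{m}\Big)= \sum_{l=0}^{n}\binom{n}{l}A_{l,m\lambda}^{(r)}(x)\frac{1}{m^{l-r}}\mathcal{E}_{n-l,\lambda}^{(\alpha-1)}.$$
   Context: For nonzero real $\mu$: $(x)_{0,\mu}=1$, $(x)_{n,\mu}=x(x-\mu)\cdots(x-(n-1)\mu)$; $e_\mu^x(t)=(1+\mu t)^{x/\mu}=\sum_{n\ge0}(x)_{n,\mu}\frac{t^n}{n!}$, $e_\mu(t)=e_\mu^1(t)$. For complex $\beta$ the degenerate Euler numbers of order $\beta$ are given by $\Big(\frac{2}{e_{\lambda}(t)+1}\Big)^{\beta}=\sum_{n\ge0}\mathcal{E}_{n,\lambda}^{(\beta)}\frac{t^{n}}{n!}$ (so for $\beta=0$: $\mathcal{E}_{0,\lambda}^{(0)}=1$ and $\mathcal{E}_{n,\lambda}^{(0)}=0$ for $n\ge1$). The generalized degenerate Euler-Genocchi polynomials of order $\alpha$ are defined by $t^{r}\Big(\frac{2}{e_{\lambda}(t)+1}\Big)^{\alpha}e_{\lambda}^{x}(t)=\sum_{n\ge0}A_{n,\lambda}^{(r,\alpha)}(x)\frac{t^{n}}{n!}$, and the generalized degenerate Euler-Genocchi polynomials $A_{n,\mu}^{(r)}(x)$ by $\frac{2t^{r}}{e_{\mu}(t)+1}e_{\mu}^{x}(t)=\sum_{n\ge0}A_{n,\mu}^{(r)}(x)\frac{t^{n}}{n!}$.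 *)

theory Defs
  imports "HOL-Computational_Algebra.Formal_Power_Series"
begin

text \<open>
  All generating functions are formal power series in \<open>t = fps_X\<close> over the complex numbers.
  For a series with constant term 1, \<open>fps_cpow f c\<close> is the binomial series
  \<open>\<Sum>k. (c gchoose k) * (f - 1) ^ k\<close>, i.e. the power \<open>f\<^sup>c\<close> taken on the branch with
  constant term 1. It is only meaningful if \<open>fps_nth f 0 = 1\<close>.
\<close>

definition fps_cpow :: "complex fps \<Rightarrow> complex \<Rightarrow> complex fps" where
  "fps_cpow f c = fps_compose (fps_binomial c) (f - 1)"

definition deg_fallfact :: "real \<Rightarrow> complex \<Rightarrow> nat \<Rightarrow> complex" where
  "deg_fallfact \<mu> x n = (\<Prod>i<n. x - of_nat i * of_real \<mu>)"

text \<open>For \<open>\<mu> \<noteq> 0\<close> this is \<open>(1 + \<mu> t)\<^bsup>x/\<mu>\<^esup>\<close>, see \<open>deg_exp_eq_cpow\<close> below.\<close>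

definition deg_exp :: "real \<Rightarrow> complex \<Rightarrow> complex fps" where
  "deg_exp \<mu> x = Abs_fps (\<lambda>n. deg_fallfact \<mu> x n / fact n)"

definition deg_euler_base :: "real \<Rightarrow> complex fps" where
  "deg_euler_base \<mu> = 2 / (deg_exp \<mu> 1 + 1)"

definition deg_euler_number :: "real \<Rightarrow> complex \<Rightarrow> nat \<Rightarrow> complex" where
  "deg_euler_number \<mu> \<beta> n = fact n * fps_nth (fps_cpow (deg_euler_base \<mu>) \<beta>) n"

definition deg_euler_genocchi_order :: "real \<Rightarrow> nat \<Rightarrow> complex \<Rightarrow> nat \<Rightarrow> complex \<Rightarrow> complex" where
  "deg_euler_genocchi_order \<mu> r \<alpha> n x =
     fact n * fps_nth (fps_X ^ r * fps_cpow (deg_euler_base \<mu>) \<alpha> * deg_exp \<mu> x) n"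

definition deg_euler_genocchi :: "real \<Rightarrow> nat \<Rightarrow> nat \<Rightarrow> complex \<Rightarrow> complex" where
  "deg_euler_genocchi \<mu> r n x =
     fact n * fps_nth (2 * fps_X ^ r / (deg_exp \<mu> 1 + 1) * deg_exp \<mu> x) n"

lemma deg_exp_eq_cpow:
  assumes "\<mu> \<noteq> 0"
  shows "deg_exp \<mu> x = fps_cpow (1 + fps_const (of_real \<mu>) * fps_X) (x / of_real \<mu>)"
proof (rule fps_ext)
  fix n
  have "deg_fallfact \<mu> x n = of_real \<mu> ^ n * (\<Prod>i<n. x / of_real \<mu> - of_nat i)"
    unfolding deg_fallfact_def using assms
    by (induction n) (auto simp: field_simps)
  thus "fps_nth (deg_exp \<mu> x) n =
      fps_nth (fps_cpow (1 + fps_const (of_real \<mu>) * fps_X) (x / of_real \<mu>)) n"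
    by (simp add: deg_exp_def fps_cpow_def fps_compose_linear gbinomial_prod_rev
          atLeast0LessThan)
qed

lemma deg_euler_base_nth_0: "fps_nth (deg_euler_base \<mu>) 0 = 1"
  by (simp add: deg_euler_base_def deg_exp_def deg_fallfact_def fps_divide_unit)

lemma fps_cpow_add:
  assumes "fps_nth f 0 = 1"
  shows "fps_cpow f (a + b) = fps_cpow f a * fps_cpow f b"
  using assms by (simp add: fps_cpow_def fps_binomial_add_mult fps_compose_mult_distrib)

lemma fps_cpow_of_nat:
  assumes "fps_nth f 0 = 1"
  shows "fps_cpow f (of_nat n) = f ^ n"
  using assms
  by (simp add: fps_cpow_def fps_binomial_of_nat fps_compose_power [symmetric]
        fps_compose_add_distrib)

lemma deg_euler_number_order_0: "deg_euler_number \<mu> 0 n = (if n = 0 then 1 else 0)"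
  by (simp add: deg_euler_number_def fps_cpow_def)

end

theory Submission
  imports Defs
begin

text \<open>
  Put \<open>q = e\<^sub>\<lambda>\<^bsup>1/m\<^esup>\<close>. As \<open>m\<close> is odd, \<open>(1 + q) (\<Sum>k<m. (-q)\<^sup>k) = 1 + q\<^sup>m = 1 + e\<^sub>\<lambda>\<close>, which
  cancels one factor \<open>2 / (e\<^sub>\<lambda> + 1)\<close> of the generating function and leaves \<open>2 / (q + 1)\<close>
  instead. Since \<open>e\<^sub>\<lambda>\<^bsup>y/m\<^esup>(t) = e\<^bsub>m\<lambda>\<^esub>\<^bsup>y\<^esup>(t/m)\<close>, the remaining product is the generating
  function of the polynomials \<open>A\<close> with parameter \<open>m\<lambda>\<close>, taken at \<open>t/m\<close>, times that of the
  Euler numbers of order \<open>\<alpha> - 1\<close>.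
\<close>

text \<open>Each of the \<open>n\<close> factors \<open>y / m - i * \<mu>\<close> equals
  \<open>(y - i * (m * \<mu>)) / m\<close>.\<close>

lemma deg_fallfact_scale:
  assumes "m > 0"
  shows "deg_fallfact \<mu> (y / of_nat m) n =
    (1 / of_nat m) ^ n * deg_fallfact (of_nat m * \<mu>) y n"
  using assms unfolding deg_fallfact_def
  by (induction n) (auto simp: field_simps)

lemma deg_exp_scale:
  assumes "m > 0"
  shows "deg_exp \<mu> (y / of_nat m) =
    deg_exp (of_nat m * \<mu>) y oo (fps_const (1 / of_nat m) * fps_X)"
  by (rule fps_ext) (simp only: fps_compose_linear deg_exp_def fps_nth_Abs_fps
    deg_fallfact_scale[OF assms] times_divide_eq_right)

lemma deg_exp_0: "deg_exp \<mu> 0 = 1"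
  by (rule fps_ext) (auto simp: deg_exp_def deg_fallfact_def)

lemma deg_exp_add:
  assumes "\<mu> \<noteq> 0"
  shows "deg_exp \<mu> (x + y) = deg_exp \<mu> x * deg_exp \<mu> y"
  using assms by (simp add: deg_exp_eq_cpow add_divide_distrib fps_cpow_add)

lemma deg_exp_of_nat_mult:
  assumes "\<mu> \<noteq> 0"
  shows "deg_exp \<mu> (of_nat k * y) = deg_exp \<mu> y ^ k"
  by (induction k) (simp_all add: deg_exp_0 deg_exp_add[OF assms] algebra_simps)

lemma deg_exp_plus_1_nth_0: "fps_nth (deg_exp \<mu> y + 1) 0 = 2"
  by (simp add: deg_exp_def deg_fallfact_def)

text \<open>The constant term 2 makes the denominator a unit, so the division is exact.\<close>

lemma fps_divide_deg_exp_plus_1_mult: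
  "f / (deg_exp \<mu> y + 1) * (deg_exp \<mu> y + 1) = f"
  using deg_exp_plus_1_nth_0[of \<mu> y]
  by (simp add: fps_divide_unit mult.assoc inverse_mult_eq_1)

text \<open>A geometric sum with ratio \<open>-q\<close>; oddness of \<open>m\<close> turns
  \<open>1 - (-q) ^ m\<close> into \<open>1 + q ^ m\<close>.\<close>

lemma alternating_sum_power:
  fixes q :: "'a :: comm_ring_1"
  assumes "odd m"
  shows "(1 + q) * (\<Sum>k<m. (-1) ^ k * q ^ k) = 1 + q ^ m"
  using one_diff_power_eq[of "-q" m] assms
  by (simp add: power_mult_distrib[symmetric])

text \<open>The factor \<open>m ^ r\<close> undoes the scaling of \<open>fps_X ^ r\<close> when
  \<open>t/m\<close> is substituted for \<open>t\<close> in \<open>F\<close>.\<close>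

lemma genocchi_generating_function_identity:
  fixes \<alpha> x :: complex and r :: nat
  assumes "\<mu> \<noteq> 0" and "odd m"
  defines "F \<equiv> 2 * fps_X ^ r / (deg_exp (of_nat m * \<mu>) 1 + 1) * deg_exp (of_nat m * \<mu>) x"
  shows "fps_X ^ r * fps_cpow (deg_euler_base \<mu>) \<alpha> *
           (\<Sum>k<m. (-1) ^ k * deg_exp \<mu> ((x + of_nat k) / of_nat m)) =
         fps_const (of_nat m ^ r) * (F oo (fps_const (1 / of_nat m) * fps_X)) *
           fps_cpow (deg_euler_base \<mu>) (\<alpha> - 1)"
proof -
  have m: "m > 0"
    using assms(2) by (rule odd_pos)
  define s :: "complex fps" where "s = fps_const (1 / of_nat m) * fps_X"
  define q where "q = deg_exp \<mu> (1 / of_nat m)"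
  define e where "e = deg_exp \<mu> (x / of_nat m)"
  define S where "S = (\<Sum>k<m. (-1) ^ k * q ^ k)"
  define B where "B = deg_euler_base \<mu>"
  define P where "P = fps_cpow B (\<alpha> - 1)"
  have s0: "fps_nth s 0 = 0"
    by (simp add: s_def)
  \<comment> \<open>The exponent law splits \<open>(x + k) / m\<close> into \<open>x / m\<close> and
    \<open>k\<close> copies of \<open>1 / m\<close>.\<close>
  have sum: "(\<Sum>k<m. (-1) ^ k * deg_exp \<mu> ((x + of_nat k) / of_nat m)) = e * S"
    using deg_exp_of_nat_mult[OF assms(1), of _ "1 / of_nat m"]
    by (simp add: S_def e_def q_def add_divide_distrib deg_exp_add[OF assms(1)]
        sum_distrib_left mult.left_commute)
  have "q ^ m = deg_exp \<mu> 1"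
    using deg_exp_of_nat_mult[OF assms(1), of m "1 / of_nat m"] m by (simp add: q_def)
  hence S: "(q + 1) * S = deg_exp \<mu> 1 + 1"
    using alternating_sum_power[OF assms(2), of q] by (simp add: S_def add.commute)
  have B: "B * (deg_exp \<mu> 1 + 1) = 2"
    unfolding B_def deg_euler_base_def by (rule fps_divide_deg_exp_plus_1_mult)
  \<comment> \<open>Splitting off order 1 exposes the factor \<open>B\<close> that cancels against
    \<open>(q + 1) * S\<close>.\<close>
  have cpow: "fps_cpow B \<alpha> = P * B"
    using fps_cpow_add[OF deg_euler_base_nth_0, of \<mu> "\<alpha> - 1" 1]
      fps_cpow_of_nat[OF deg_euler_base_nth_0, of \<mu> 1]
    by (simp add: P_def B_def)
  have "F * (deg_exp (of_nat m * \<mu>) 1 + 1) = 2 * fps_X ^ r * deg_exp (of_nat m * \<mu>) x"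
    using fps_divide_deg_exp_plus_1_mult[of "2 * fps_X ^ r" "of_nat m * \<mu>" 1]
    by (simp add: F_def mult_ac)
  hence "(F * (deg_exp (of_nat m * \<mu>) 1 + 1)) oo s =
      (2 * fps_X ^ r * deg_exp (of_nat m * \<mu>) x) oo s"
    by simp
  \<comment> \<open>Composition with \<open>s\<close> is multiplicative because \<open>s\<close> has
    constant term 0; it sends the exponentials with parameter \<open>m * \<mu>\<close> to
    \<open>q\<close> and \<open>e\<close>.\<close>
  hence "(F oo s) * (q + 1) = 2 * s ^ r * e"
    using s0 deg_exp_scale[OF m, of \<mu> 1] deg_exp_scale[OF m, of \<mu> x]
    by (simp add: fps_compose_mult_distrib fps_compose_add_distrib
        fps_compose_power[symmetric] q_def e_def s_def)
  moreover have "fps_const (of_nat m ^ r) * s ^ r = fps_X ^ r"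
    using m by (simp add: s_def power_mult_distrib fps_const_power power_one_over
        mult.assoc[symmetric])
  ultimately have F: "fps_const (of_nat m ^ r) * (F oo s) * (q + 1) = 2 * fps_X ^ r * e"
    by (metis (no_types, lifting) mult.assoc mult.left_commute)
  \<comment> \<open>Both sides are compared after multiplication by \<open>q + 1\<close>, which is
    cancelled at the end: its constant term is 2, and the power series form an integral
    domain.\<close>
  have "(q + 1) * (fps_X ^ r * (P * B) * (e * S)) = fps_X ^ r * P * e * (B * ((q + 1) * S))"
    by (simp add: mult_ac)
  also have "\<dots> = P * (2 * fps_X ^ r * e)"
    unfolding S B by (simp add: mult_ac)
  also have "\<dots> = (q + 1) * (fps_const (of_nat m ^ r) * (F oo s) * P)"
    unfolding F[symmetric] by (simp add: mult_ac)
  finally have "(q + 1) * (fps_X ^ r * (P * B) * (e * S)) =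
      (q + 1) * (fps_const (of_nat m ^ r) * (F oo s) * P)" .
  moreover have "q + 1 \<noteq> 0"
    using deg_exp_plus_1_nth_0[of \<mu> "1 / of_nat m"]
    unfolding q_def by (metis fps_zero_nth zero_neq_numeral)
  ultimately show ?thesis
    by (simp add: sum cpow flip: s_def B_def P_def)
qed

theorem theorem8:
  fixes lam :: real and \<alpha> x :: complex and r m n :: nat
  assumes "lam \<noteq> 0" and "\<alpha> \<noteq> 0" and "m > 0" and "odd m"
  shows "(\<Sum>k = 0..m - 1. (-1) ^ k *
            deg_euler_genocchi_order lam r \<alpha> n ((x + of_nat k) / of_nat m)) =
         (\<Sum>l = 0..n. of_nat (n choose l) * deg_euler_genocchi (of_nat m * lam) r l x *
            (1 / of_nat m powi (int l - int r)) * deg_euler_number lam (\<alpha> - 1) (n - l))"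
proof -
  define F where
    "F = 2 * fps_X ^ r / (deg_exp (of_nat m * lam) 1 + 1) * deg_exp (of_nat m * lam) x"
  define P where "P = fps_cpow (deg_euler_base lam) (\<alpha> - 1)"
  define C where "C = fps_X ^ r * fps_cpow (deg_euler_base lam) \<alpha>"
  \<comment> \<open>With the sign inside the coefficient, the alternating sum becomes a single
    coefficient of a product.\<close>
  have sign: "(-1) ^ k * fps_nth f n = fps_nth ((-1) ^ k * f) n" for k and f :: "complex fps"
    by (cases "even k") auto
  have "{0..m - 1} = {..<m}"
    using assms(3) by auto
  hence "(\<Sum>k = 0..m - 1. (-1) ^ k *
      deg_euler_genocchi_order lam r \<alpha> n ((x + of_nat k) / of_nat m)) =
    fact n * fps_nth (C * (\<Sum>k<m. (-1) ^ k * deg_exp lam ((x + of_nat k) / of_nat m))) n"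
    by (simp add: deg_euler_genocchi_order_def sum_distrib_left fps_sum_nth sign
        mult.left_commute flip: C_def)
  also have "\<dots> = fact n * fps_nth (fps_const (of_nat m ^ r) *
      ((F oo (fps_const (1 / of_nat m) * fps_X)) * P)) n"
    using genocchi_generating_function_identity[OF assms(1,4), of r \<alpha> x]
    by (simp add: C_def F_def P_def mult.assoc)
  \<comment> \<open>Cauchy product; substituting \<open>t/m\<close> contributes
    \<open>(1 / m) ^ l\<close> to the coefficient of \<open>F\<close> at \<open>l\<close>.\<close>
  also have "\<dots> = (\<Sum>l = 0..n. fact n *
      (of_nat m ^ r * ((1 / of_nat m) ^ l * fps_nth F l * fps_nth P (n - l))))"
    by (simp only: fps_mult_left_const_nth fps_mult_nth[of _ P] fps_compose_linear
        fps_nth_Abs_fps sum_distrib_left)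
  also have "\<dots> = (\<Sum>l = 0..n. of_nat (n choose l) * deg_euler_genocchi (of_nat m * lam) r l x *
      (1 / of_nat m powi (int l - int r)) * deg_euler_number lam (\<alpha> - 1) (n - l))"
  proof (rule sum.cong[OF refl])
    fix l assume "l \<in> {0..n}"
    hence fact: "(fact n :: complex) = of_nat (n choose l) * fact l * fact (n - l)"
      by (simp add: binomial_fact)
    \<comment> \<open>The exponent is negative for \<open>l < r\<close>, hence the integer
      power.\<close>
    have "(1 / of_nat m powi (int l - int r) :: complex) = of_nat m ^ r * (1 / of_nat m) ^ l"
      using assms(3) by (simp add: power_int_diff power_one_over)
    thus "fact n * (of_nat m ^ r * ((1 / of_nat m) ^ l * fps_nth F l * fps_nth P (n - l))) =
      of_nat (n choose l) * deg_euler_genocchi (of_nat m * lam) r l x *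
      (1 / of_nat m powi (int l - int r)) * deg_euler_number lam (\<alpha> - 1) (n - l)"
      unfolding fact deg_euler_genocchi_def deg_euler_number_def F_def P_def
      by (simp add: mult_ac)
  qed
  finally show ?thesis .
qed

end
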